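(* The pushdown to $\mathcal M$ of the metric $h_2$ (the case $c=2$ of the family $h_c$) is $$g_2=\tfrac12dR^2+\tfrac12\big|d\mathbf u+d\mathbf v\big|^2+\frac2N|\mathbf B|^2+\frac1{2N}\Gamma_+^2-\frac1{4N}\Gamma_-^2,$$ where $N=N_2=6uv-2\,\mathbf u\cdot\mathbf v$.
   Context: Let $x_0,\dots,x_7$ be the standard coordinates on $\mathbb R^8$, with partial derivatives $\partial_i$, and let $e=\sum_i dx_i\otimes dx_i$ and $R=\sum_i x_i^2$. Put $X=-x_1\partial_0+x_0\partial_1-x_3\partial_2+x_2\partial_3-x_5\partial_4+x_4\partial_5-x_7\partial_6+x_6\partial_7$, $Y_1=-x_1\partial_0+x_0\partial_1+x_3\partial_2-x_2\partial_3-x_5\partial_4+x_4\partial_5+x_7\partial_6-x_6\partial_7$, $Y_2=-x_2\partial_0+x_0\partial_2+x_1\partial_3-x_3\partial_1-x_6\partial_4+x_4\partial_6+x_5\partial_7-x_7\partial_5$, $Y_3=-x_3\partial_0+x_0\partial_3+x_2\partial_1-x_1\partial_2-x_7\partial_4+x_4\partial_7+x_6\partial_5-x_5\partial_6$, and $\alpha_i=e(Y_i,\cdot)$. The flow of $Y_1$ is a free circle action on $\mathbb R^8\setminus0$ with quotient $\mathcal C=\mathbb R^+\times\mathbb{CP}^3$; tensors on $\mathcal C$ are identified with their pullbacks to $\mathbb R^8\setminus 0$. For $c<3$, $h_c=\tfrac12dR^2+2R\,e-2\alpha_1^2+(1-c)(\alpha_2^2+\alpha_3^2)$ defines a Riemannian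 metric on $\mathcal C$ ($h_2$ is the conical metric with holonomy $G_2$). The vector field $X$ generates a circle action on $\mathcal C$; its quotient is $Q:\mathcal C\to\mathcal M\cong\mathbb R^6\setminus0$, with coordinates $(\mathbf u,\mathbf v)=(u_1,u_2,u_3;v_1,v_2,v_3)$ given by $u_1=x_0^2+x_1^2-x_4^2-x_5^2$, $u_2=2(x_0x_4+x_1x_5)$, $u_3=2(x_0x_5-x_1x_4)$, $v_1=x_2^2+x_3^2-x_6^2-x_7^2$, $v_2=2(x_2x_6+x_3x_7)$, $v_3=2(x_2x_7-x_3x_6)$. Also $u=|\mathbf u|$, $v=|\mathbf v|$, and $R=u+v$. Let $N_c=h_c(X,X)$ and $\Theta_c=\frac{2}{N_c}h_c(X,\cdot)$. The pushdown of $h_c$ is the Riemannian metric $g_c$ on $\mathcal M$ (where $uv\neq0$) determined by $h_c=Q^*g_c+\tfrac14h_c(X,X)\,\Theta_c\otimes\Theta_c$. Further notation, where $uv\ne0$: $\mathbf A_\pm=v\mathbf u\mp u\mathbf v$; $\mathbf B=u\,d\mathbf v-v\,d\mathbf u$ (a vector-valued 1-form); $\Gamma_\pm=\frac1{uv}\mathbf A_\pm\cdot\mathbf B$ (scalar 1-forms). For a vector-valued 1-form $\mathbf A$, $|\mathbf A|^2=\mathbf A\cdot\mathbf A=\sum_iA_i\otimes A_i$. *)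

theory Defs
  imports "HOL-Analysis.Analysis"
begin

text \<open>
  Tensor fields on (subsets of) a normed space are represented by their values on constant vectors:
  a (vector-valued) 1-form by a map taking a point and a tangent vector, a covariant 2-tensor by a
  map taking a point and two tangent vectors.
\<close>

type_synonym 'a oneform = "'a \<Rightarrow> 'a \<Rightarrow> real"
type_synonym 'a tensor2 = "'a \<Rightarrow> 'a \<Rightarrow> 'a \<Rightarrow> real"

definition differential ::
    "('a::real_normed_vector \<Rightarrow> 'b::real_normed_vector) \<Rightarrow> 'a \<Rightarrow> 'a \<Rightarrow> 'b" where
  "differential f p a = frechet_derivative f (at p) a"

definition tensor_prod :: "'a oneform \<Rightarrow> 'a oneform \<Rightarrow> 'a tensor2" where
  "tensor_prod \<alpha> \<beta> p a b = \<alpha> p a * \<beta> p b"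

abbreviation tensor_sq :: "'a oneform \<Rightarrow> 'a tensor2" where
  "tensor_sq \<alpha> \<equiv> tensor_prod \<alpha> \<alpha>"

text \<open>For a vector-valued 1-form $A$ this is $|A|^2 = \sum_i A_i \otimes A_i$.\<close>

definition norm_sq_form :: "('a \<Rightarrow> 'a \<Rightarrow> 'b::real_inner) \<Rightarrow> 'a tensor2" where
  "norm_sq_form A p a b = A p a \<bullet> A p b"

definition pullback ::
    "('a::real_normed_vector \<Rightarrow> 'b::real_normed_vector) \<Rightarrow> 'b tensor2 \<Rightarrow> 'a tensor2" where
  "pullback F g x a b = g (F x) (differential F x a) (differential F x b)"

text \<open>Differentiability of class $C^k$ and $C^\infty$ on an open subset of a Euclidean space, by
  iterated directional derivatives.\<close>

primrec Ck_on :: "nat \<Rightarrow> 'a::euclidean_space set \<Rightarrow> ('a \<Rightarrow> real) \<Rightarrow> bool" where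
  "Ck_on 0 S f \<longleftrightarrow> continuous_on S f"
| "Ck_on (Suc k) S f \<longleftrightarrow>
     (\<forall>x\<in>S. f differentiable (at x)) \<and> (\<forall>w. Ck_on k S (\<lambda>x. differential f x w))"

definition Cinf_on :: "'a::euclidean_space set \<Rightarrow> ('a \<Rightarrow> real) \<Rightarrow> bool" where
  "Cinf_on S f \<longleftrightarrow> (\<forall>k. Ck_on k S f)"

definition riemannian_metric_on :: "'a::euclidean_space set \<Rightarrow> 'a tensor2 \<Rightarrow> bool" where
  "riemannian_metric_on S g \<longleftrightarrow>
     open S \<and>
     (\<forall>p\<in>S. bilinear (g p) \<and> (\<forall>a b. g p a b = g p b a) \<and> (\<forall>a. a \<noteq> 0 \<longrightarrow> 0 < g p a a)) \<and>
     (\<forall>a b. Cinf_on S (\<lambda>p. g p a b))"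


text \<open>
  The eight indices of \<^typ>\<open>real^8\<close> are \<open>0, 1, \<dots>, 7\<close> (arithmetic in the index type is modulo 8),
  so that \<open>x $ i\<close> is the coordinate $x_i$.
\<close>

abbreviation pd :: "8 \<Rightarrow> real^8" where
  "pd i \<equiv> axis i 1"

definition X_field :: "real^8 \<Rightarrow> real^8" where
  "X_field x =
     - (x$1) *\<^sub>R pd 0 + (x$0) *\<^sub>R pd 1 - (x$3) *\<^sub>R pd 2 + (x$2) *\<^sub>R pd 3
     - (x$5) *\<^sub>R pd 4 + (x$4) *\<^sub>R pd 5 - (x$7) *\<^sub>R pd 6 + (x$6) *\<^sub>R pd 7"

definition Y1_field :: "real^8 \<Rightarrow> real^8" where
  "Y1_field x =
     - (x$1) *\<^sub>R pd 0 + (x$0) *\<^sub>R pd 1 + (x$3) *\<^sub>R pd 2 - (x$2) *\<^sub>R pd 3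
     - (x$5) *\<^sub>R pd 4 + (x$4) *\<^sub>R pd 5 + (x$7) *\<^sub>R pd 6 - (x$6) *\<^sub>R pd 7"

definition Y2_field :: "real^8 \<Rightarrow> real^8" where
  "Y2_field x =
     - (x$2) *\<^sub>R pd 0 + (x$0) *\<^sub>R pd 2 + (x$1) *\<^sub>R pd 3 - (x$3) *\<^sub>R pd 1
     - (x$6) *\<^sub>R pd 4 + (x$4) *\<^sub>R pd 6 + (x$5) *\<^sub>R pd 7 - (x$7) *\<^sub>R pd 5"

definition Y3_field :: "real^8 \<Rightarrow> real^8" where
  "Y3_field x =
     - (x$3) *\<^sub>R pd 0 + (x$0) *\<^sub>R pd 3 + (x$2) *\<^sub>R pd 1 - (x$1) *\<^sub>R pd 2
     - (x$7) *\<^sub>R pd 4 + (x$4) *\<^sub>R pd 7 + (x$6) *\<^sub>R pd 5 - (x$5) *\<^sub>R pd 6"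

definition eucl :: "(real^8) tensor2" where
  "eucl x a b = (\<Sum>i\<in>UNIV. a$i * b$i)"

definition R8 :: "real^8 \<Rightarrow> real" where
  "R8 x = (\<Sum>i\<in>UNIV. (x$i)\<^sup>2)"

definition alpha1 :: "(real^8) oneform" where "alpha1 x a = eucl x (Y1_field x) a"
definition alpha2 :: "(real^8) oneform" where "alpha2 x a = eucl x (Y2_field x) a"
definition alpha3 :: "(real^8) oneform" where "alpha3 x a = eucl x (Y3_field x) a"

text \<open>
  The metric $h_c$ on $\mathcal C = \mathbb R^+ \times \mathbb{CP}^3$, the quotient of
  $\mathbb R^8 \setminus 0$ by the flow of \<^const>\<open>Y1_field\<close>, is represented by its pullback to
  $\mathbb R^8 \setminus 0$ (for $c < 3$ a semi-definite tensor whose kernel is spanned by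
  \<^const>\<open>Y1_field\<close>).
\<close>

definition h :: "real \<Rightarrow> (real^8) tensor2" where
  "h c x a b =
     1/2 * tensor_sq (differential R8) x a b + 2 * R8 x * eucl x a b
     - 2 * tensor_sq alpha1 x a b
     + (1 - c) * (tensor_sq alpha2 x a b + tensor_sq alpha3 x a b)"

definition Nc :: "real \<Rightarrow> real^8 \<Rightarrow> real" where
  "Nc c x = h c x (X_field x) (X_field x)"

definition Theta :: "real \<Rightarrow> (real^8) oneform" where
  "Theta c x a = 2 / Nc c x * h c x (X_field x) a"


type_synonym M_space = "(real^3) \<times> (real^3)"

text \<open>The quotient map by the circle action generated by \<^const>\<open>X_field\<close>, as a map on
  $\mathbb R^8$ (it is also invariant under the flow of \<^const>\<open>Y1_field\<close>).\<close>

definition Qmap :: "real^8 \<Rightarrow> M_space" where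
  "Qmap x =
    (vector [(x$0)\<^sup>2 + (x$1)\<^sup>2 - (x$4)\<^sup>2 - (x$5)\<^sup>2,
             2 * (x$0 * x$4 + x$1 * x$5),
             2 * (x$0 * x$5 - x$1 * x$4)],
     vector [(x$2)\<^sup>2 + (x$3)\<^sup>2 - (x$6)\<^sup>2 - (x$7)\<^sup>2,
             2 * (x$2 * x$6 + x$3 * x$7),
             2 * (x$2 * x$7 - x$3 * x$6)])"

definition uvec :: "M_space \<Rightarrow> real^3" where "uvec p = fst p"
definition vvec :: "M_space \<Rightarrow> real^3" where "vvec p = snd p"
definition ulen :: "M_space \<Rightarrow> real" where "ulen p = norm (uvec p)"
definition vlen :: "M_space \<Rightarrow> real" where "vlen p = norm (vvec p)"

text \<open>The function $R$ on $\mathcal M$; its pullback under \<^const>\<open>Qmap\<close> is \<^const>\<open>R8\<close>.\<close>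

definition RM :: "M_space \<Rightarrow> real" where "RM p = ulen p + vlen p"

definition M_reg :: "M_space set" where
  "M_reg = {p. ulen p * vlen p \<noteq> 0}"

definition is_pushdown :: "real \<Rightarrow> M_space tensor2 \<Rightarrow> bool" where
  "is_pushdown c g \<longleftrightarrow>
     riemannian_metric_on M_reg g \<and>
     (\<forall>x. x \<noteq> 0 \<longrightarrow> Qmap x \<in> M_reg \<longrightarrow> (\<forall>a b.
        h c x a b = pullback Qmap g x a b
          + 1/4 * h c x (X_field x) (X_field x) * tensor_prod (Theta c) (Theta c) x a b))"

definition A_plus :: "M_space \<Rightarrow> real^3" where
  "A_plus p = vlen p *\<^sub>R uvec p - ulen p *\<^sub>R vvec p"

definition A_minus :: "M_space \<Rightarrow> real^3" where
  "A_minus p = vlen p *\<^sub>R uvec p + ulen p *\<^sub>R vvec p"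

definition B_form :: "M_space \<Rightarrow> M_space \<Rightarrow> real^3" where
  "B_form p a = ulen p *\<^sub>R differential vvec p a - vlen p *\<^sub>R differential uvec p a"

definition Gamma_plus :: "M_space oneform" where
  "Gamma_plus p a = 1 / (ulen p * vlen p) * (A_plus p \<bullet> B_form p a)"

definition Gamma_minus :: "M_space oneform" where
  "Gamma_minus p a = 1 / (ulen p * vlen p) * (A_minus p \<bullet> B_form p a)"

end

theory Submission
  imports Defs
begin

text \<open>
  Group the coordinates into $\psi = (x_0 + i x_1, x_4 + i x_5)$ and $\varphi = (x_2 + i x_3, x_6 + i x_7)$
  in $\mathbb C^2$. Then $\mathbf u$ and $\mathbf v$ are the Hopf images of $\psi$ and $\varphi$, so that
  $u = |\psi|^2$, $v = |\varphi|^2$ and $uv + \mathbf u \cdot \mathbf v = 2 |\sigma|^2$ with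
  $\sigma = \langle\psi,\varphi\rangle$. Everything in $N h_2$ and in the pullback of $N g_2$ is a polynomial in
  the Hermitian products of $\psi, \varphi, d\psi, d\varphi$; the products of two differentials enter the
  difference only with the factor $D = uv - |\sigma|^2$, and since $\mathbb C^2$ is two-dimensional,
  $D \langle d\psi, d\varphi\rangle$ (and likewise $D|d\psi|^2$, $D|d\varphi|^2$) is a combination of products of
  differentials with $\psi$ and $\varphi$. What remains is a polynomial identity. Uniqueness holds because
  the quotient map is a surjective submersion over the set $uv \neq 0$.
\<close>

subsection \<open>Smooth functions\<close>

lemma differential_eq: "(f has_derivative f') (at p) \<Longrightarrow> differential f p = f'"
  unfolding differential_def by (metis frechet_derivative_at)

lemma differential_has_derivative:
  "f differentiable (at p) \<Longrightarrow> (f has_derivative differential f p) (at p)"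
  unfolding differential_def by (metis eta_contract_eq frechet_derivative_works)

text \<open>Near a point of an open set on which they agree, two functions have the same derivative;
  the induction then passes to the directional differentials. This allows \<open>g2\<close> to be
  differentiated through a formula valid only on \<open>M_reg\<close>.\<close>

lemma Ck_on_cong:
  assumes "open S" "\<And>x. x \<in> S \<Longrightarrow> f x = g x"
  shows "Ck_on k S f \<longleftrightarrow> Ck_on k S g"
  using assms(2)
proof (induction k arbitrary: f g)
  case 0
  then show ?case by (auto cong: continuous_on_cong)
next
  case (Suc k)
  have "(f has_derivative f') (at x) \<longleftrightarrow> (g has_derivative f') (at x)" if "x \<in> S" for x f'
    using has_derivative_transform_within_open[OF _ assms(1) that] Suc.prems by metis
  hence "f differentiable (at x) \<longleftrightarrow> g differentiable (at x)" "differential f x = differential g x"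
    if "x \<in> S" for x
    using that by (auto simp: differentiable_def differential_def frechet_derivative_def)
  thus ?case
    using Suc.IH[of "\<lambda>x. differential f x w" "\<lambda>x. differential g x w" for w] by auto
qed

text \<open>Only level 0 of \<open>Ck_on\<close> speaks of continuity, so the descent ends with
  differentiability implying continuity. It supplies the undifferentiated factors in the product
  rule.\<close>

lemma Ck_on_SucD: "Ck_on (Suc k) S f \<Longrightarrow> Ck_on k S f"
proof (induction k arbitrary: f)
  case 0
  then show ?case
    by (auto intro!: continuous_at_imp_continuous_on differentiable_imp_continuous_within)
next
  case (Suc k)
  then show ?case by (metis Ck_on.simps(2))
qed

text \<open>Replaces \<open>differential\<close>, which rests on a choice operator, by an explicit
  derivative formula on \<open>S\<close>. Closure under sums, products, inverses and roots goes
  through this rule.\<close>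

lemma Ck_on_SucI:
  assumes "open S" "\<And>x. x \<in> S \<Longrightarrow> (f has_derivative f' x) (at x)"
    and "\<And>w. Ck_on k S (\<lambda>x. f' x w)"
  shows "Ck_on (Suc k) S f"
proof -
  have "Ck_on k S (\<lambda>x. differential f x w)" for w
    using Ck_on_cong[OF assms(1), of "\<lambda>x. differential f x w" "\<lambda>x. f' x w"]
      differential_eq[OF assms(2)] assms(3) by simp
  thus ?thesis using assms(2) by (auto simp: differentiable_def)
qed

lemma Ck_on_const: "Ck_on k S (\<lambda>x. c)"
proof (induction k arbitrary: c)
  case (Suc k)
  have "differential (\<lambda>x. c) p = (\<lambda>w. 0)" for p :: 'a
    by (rule differential_eq) simp
  with Suc show ?case by simp
qed simp

lemma Ck_on_bounded_linear: "bounded_linear f \<Longrightarrow> Ck_on k S f"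
proof (cases k)
  case (Suc n)
  assume f: "bounded_linear f"
  have "differential f p = f" for p by (rule differential_eq) (simp add: f bounded_linear_imp_has_derivative)
  thus ?thesis using f Suc by (auto simp: Ck_on_const bounded_linear_imp_differentiable)
qed (simp add: linear_continuous_on)

lemma Ck_on_add:
  assumes "open S"
  shows "Ck_on k S f \<Longrightarrow> Ck_on k S g \<Longrightarrow> Ck_on k S (\<lambda>x. f x + g x)"
proof (induction k arbitrary: f g)
  case (Suc k)
  show ?case
  proof (rule Ck_on_SucI[OF assms])
    show "((\<lambda>x. f x + g x) has_derivative (\<lambda>w. differential f x w + differential g x w)) (at x)"
      if "x \<in> S" for x
      using Suc.prems that by (auto intro!: has_derivative_add differential_has_derivative)
  qed (use Suc in auto)
qed (auto intro: continuous_intros)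

lemma Ck_on_mult:
  assumes "open S"
  shows "Ck_on k S f \<Longrightarrow> Ck_on k S g \<Longrightarrow> Ck_on k S (\<lambda>x. f x * g x)"
proof (induction k arbitrary: f g)
  case (Suc k)
  show ?case
  proof (rule Ck_on_SucI[OF assms])
    show "((\<lambda>x. f x * g x) has_derivative (\<lambda>w. f x * differential g x w + differential f x w * g x)) (at x)"
      if "x \<in> S" for x
      using Suc.prems that by (auto intro!: has_derivative_mult differential_has_derivative)
    show "Ck_on k S (\<lambda>x. f x * differential g x w + differential f x w * g x)" for w
      using Suc.prems Suc.prems[THEN Ck_on_SucD] by (intro Ck_on_add[OF assms] Suc.IH) auto
  qed
qed (auto intro: continuous_intros)

text \<open>The derivative -f'/f^2 contains 1/f again, but one level lower, so the induction closes
  with \<open>f\<close> fixed.\<close>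

lemma Ck_on_inverse:
  assumes "open S" and "\<And>x. x \<in> S \<Longrightarrow> f x \<noteq> 0"
  shows "Ck_on k S f \<Longrightarrow> Ck_on k S (\<lambda>x. inverse (f x))"
proof (induction k)
  case (Suc k)
  show ?case
  proof (rule Ck_on_SucI[OF assms(1)])
    show "((\<lambda>x. inverse (f x)) has_derivative
        (\<lambda>w. (- 1) * (inverse (f x) * differential f x w * inverse (f x)))) (at x)"
      if "x \<in> S" for x
      using Deriv.has_derivative_inverse[OF assms(2)[OF that] differential_has_derivative[of f x]]
        Suc.prems that by simp
    show "Ck_on k S (\<lambda>x. (- 1) * (inverse (f x) * differential f x w * inverse (f x)))" for w
      using Suc.prems Suc.prems[THEN Ck_on_SucD]
      by (intro Ck_on_mult[OF assms(1)] Suc.IH Ck_on_const) auto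
  qed
qed (auto intro: continuous_intros simp: assms(2))

text \<open>As for the inverse: the derivative f'/(2 sqrt f) contains sqrt f one level lower, and
  positivity of \<open>f\<close> makes that root invertible.\<close>

lemma Ck_on_sqrt:
  assumes "open S" and "\<And>x. x \<in> S \<Longrightarrow> f x > 0"
  shows "Ck_on k S f \<Longrightarrow> Ck_on k S (\<lambda>x. sqrt (f x))"
proof (induction k)
  case (Suc k)
  show ?case
  proof (rule Ck_on_SucI[OF assms(1)])
    show "((\<lambda>x. sqrt (f x)) has_derivative
        (\<lambda>w. differential f x w * (inverse (sqrt (f x)) * (1/2)))) (at x)"
      if "x \<in> S" for x
      using assms(2)[OF that] differential_has_derivative[of f x] Suc.prems that
      by (auto intro!: derivative_eq_intros simp: field_simps)
    show "Ck_on k S (\<lambda>x. differential f x w * (inverse (sqrt (f x)) * (1/2)))" for w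
      using Suc.prems Suc.prems[THEN Ck_on_SucD]
      by (intro Ck_on_mult[OF assms(1)] Ck_on_inverse[OF assms(1)] Suc.IH Ck_on_const)
        (auto simp: less_imp_neq[OF assms(2)] dest: assms(2))
  qed
qed (auto intro: continuous_intros)

lemma Cinf_on_cong:
  "open S \<Longrightarrow> (\<And>x. x \<in> S \<Longrightarrow> f x = g x) \<Longrightarrow> Cinf_on S f \<longleftrightarrow> Cinf_on S g"
  unfolding Cinf_on_def using Ck_on_cong by blast

lemma Cinf_on_const: "Cinf_on S (\<lambda>x. c)"
  and Cinf_on_bounded_linear: "bounded_linear f \<Longrightarrow> Cinf_on S f"
  by (simp_all add: Cinf_on_def Ck_on_const Ck_on_bounded_linear)

context
  fixes S :: "'a::euclidean_space set" and f g :: "'a \<Rightarrow> real"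
  assumes S: "open S" and f: "Cinf_on S f"
begin

lemma Cinf_on_add: "Cinf_on S g \<Longrightarrow> Cinf_on S (\<lambda>x. f x + g x)"
  and Cinf_on_mult: "Cinf_on S g \<Longrightarrow> Cinf_on S (\<lambda>x. f x * g x)"
  using f by (simp_all add: Cinf_on_def Ck_on_add Ck_on_mult S)

lemma Cinf_on_inverse: "(\<And>x. x \<in> S \<Longrightarrow> f x \<noteq> 0) \<Longrightarrow> Cinf_on S (\<lambda>x. inverse (f x))"
  and Cinf_on_sqrt: "(\<And>x. x \<in> S \<Longrightarrow> f x > 0) \<Longrightarrow> Cinf_on S (\<lambda>x. sqrt (f x))"
  using f by (simp_all add: Cinf_on_def Ck_on_inverse Ck_on_sqrt S)

end

lemma Cinf_on_diff:
  "open S \<Longrightarrow> Cinf_on S f \<Longrightarrow> Cinf_on S g \<Longrightarrow> Cinf_on S (\<lambda>x. f x - g x)"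
  using Cinf_on_add[of S f "\<lambda>x. - 1 * g x"] Cinf_on_mult[of S "\<lambda>x. - 1" g] Cinf_on_const[of S "- 1"] by simp

lemma Cinf_on_divide:
  "open S \<Longrightarrow> Cinf_on S f \<Longrightarrow> Cinf_on S g \<Longrightarrow> (\<And>x. x \<in> S \<Longrightarrow> g x \<noteq> 0) \<Longrightarrow>
    Cinf_on S (\<lambda>x. f x / g x)"
  by (simp add: divide_inverse Cinf_on_mult Cinf_on_inverse)

lemma Cinf_on_sum:
  assumes "open S" "\<And>i. i \<in> I \<Longrightarrow> Cinf_on S (f i)"
  shows "Cinf_on S (\<lambda>x. \<Sum>i\<in>I. f i x)"
  using assms(2)
proof (induction I rule: infinite_finite_induct)
  case (insert i I)
  thus ?case by (simp add: Cinf_on_add assms(1))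
qed (simp_all add: Cinf_on_const)

subsection \<open>Hermitian products in $\mathbb C^2$\<close>

text \<open>
  Real and imaginary parts of a Hermitian product are written separately: with
  $z = (z_1 + i z_2, z_3 + i z_4)$ and similarly $w, a, b$, the pair \<open>(sr, si)\<close> is
  $\langle z, w\rangle$, \<open>(m, t)\<close> is $\langle z, a\rangle$, \<open>(n, s)\<close> is $\langle w, b\rangle$, \<open>(pr, pj)\<close> is
  $\langle z, b\rangle$, \<open>(qr, qi)\<close> is $\langle a, w\rangle$ and \<open>(rr, ri)\<close> is $\langle a, b\rangle$.
\<close>

lemma gram_norm:
  fixes z1 z2 z3 z4 w1 w2 w3 w4 a1 a2 a3 a4 :: real
  defines "u \<equiv> z1^2+z2^2+z3^2+z4^2" and "v \<equiv> w1^2+w2^2+w3^2+w4^2"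
   and "sr \<equiv> z1 * w1+z2 * w2+z3 * w3+z4 * w4" and "si \<equiv> z1 * w2-z2 * w1+z3 * w4-z4 * w3"
   and "m \<equiv> z1 * a1+z2 * a2+z3 * a3+z4 * a4" and "t \<equiv> z1 * a2-z2 * a1+z3 * a4-z4 * a3"
   and "qr \<equiv> a1 * w1+a2 * w2+a3 * w3+a4 * w4" and "qi \<equiv> a1 * w2-a2 * w1+a3 * w4-a4 * w3"
  shows "(u * v-sr^2-si^2) * (a1^2+a2^2+a3^2+a4^2) = v * (m^2+t^2)+u * (qr^2+qi^2)
     -2 * ((m * sr+t * si) * qr+(m * si-t * sr) * qi)"
  unfolding assms by algebra

text \<open>The matrix of products of z, w, a with z, w, b is singular for the same reason; the two
  claims are the real and imaginary parts of its expanded determinant.\<close>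

lemma gram_inner:
  fixes z1 z2 z3 z4 w1 w2 w3 w4 a1 a2 a3 a4 b1 b2 b3 b4 :: real
  defines "u \<equiv> z1^2+z2^2+z3^2+z4^2" and "v \<equiv> w1^2+w2^2+w3^2+w4^2"
   and "sr \<equiv> z1 * w1+z2 * w2+z3 * w3+z4 * w4" and "si \<equiv> z1 * w2-z2 * w1+z3 * w4-z4 * w3"
   and "m \<equiv> z1 * a1+z2 * a2+z3 * a3+z4 * a4" and "t \<equiv> z1 * a2-z2 * a1+z3 * a4-z4 * a3"
   and "n \<equiv> w1 * b1+w2 * b2+w3 * b3+w4 * b4" and "s \<equiv> w1 * b2-w2 * b1+w3 * b4-w4 * b3"
   and "pr \<equiv> z1 * b1+z2 * b2+z3 * b3+z4 * b4" and "pj \<equiv> z1 * b2-z2 * b1+z3 * b4-z4 * b3"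
   and "qr \<equiv> a1 * w1+a2 * w2+a3 * w3+a4 * w4" and "qi \<equiv> a1 * w2-a2 * w1+a3 * w4-a4 * w3"
   and "rr \<equiv> a1 * b1+a2 * b2+a3 * b3+a4 * b4" and "ri \<equiv> a1 * b2-a2 * b1+a3 * b4-a4 * b3"
  shows "(u * v-sr^2-si^2) * rr = v * (m * pr+t * pj)+u * (qr * n-qi * s)
     -((m * sr+t * si) * n-(m * si-t * sr) * s) - ((qr * sr+qi * si) * pr-(qi * sr-qr * si) * pj)"
   and "(u * v-sr^2-si^2) * ri = v * (m * pj-t * pr)+u * (qr * s+qi * n)
     -((m * sr+t * si) * s+(m * si-t * sr) * n) - ((qr * sr+qi * si) * pj+(qi * sr-qr * si) * pr)"
  unfolding assms by algebra+

text \<open>The pushdown equation on one tangent vector, multiplied by N; the last square is that of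
  h_2(X,.). Here \<open>k\<close> stands for the inner product of the vectors u and v,
  \<open>A\<close>, \<open>B\<close>, \<open>dd\<close> for the products of their differentials,
  \<open>ua\<close> and \<open>va\<close> for u.dv and v.du, and 2 m1, 2 m2 for the differentials of
  the lengths. The assumed relations are the vanishing Gram determinants.\<close>

lemma hermitian_identity:
  fixes u v sr si m1 t1 m2 t2 pr pj qr qi E1 E2 rr ri :: real
  defines "D \<equiv> u * v - sr^2-si^2"
  defines "k \<equiv> 2 * (sr^2+si^2)-u * v" 
  defines "N \<equiv> 6 * u * v-2 * k"
  defines "dd \<equiv> 4 * (sr * rr+si * ri)+4 * (pr * qr+pj * qi)-4 * m1 * m2"
  defines "A \<equiv> 4 * u * E1-4 * t1^2" and "B \<equiv> 4 * v * E2-4 * t2^2"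
  defines "ua \<equiv> 4 * (sr * pr+si * pj)-2 * u * m2" and "va \<equiv> 4 * (sr * qr+si * qi)-2 * v * m1"
  assumes "D * E1 = v * (m1^2+t1^2)+u * (qr^2+qi^2)-2 * ((m1 * sr+t1 * si) * qr+(m1 * si-t1 * sr) * qi)"
   and "D * E2 = u * (m2^2+t2^2)+v * (pr^2+pj^2)-2 * ((m2 * sr-t2 * si) * pr+(m2 * si+t2 * sr) * pj)"
   and "D * rr = v * (m1 * pr+t1 * pj)+u * (qr * m2-qi * t2)
     -((m1 * sr+t1 * si) * m2-(m1 * si-t1 * sr) * t2) - ((qr * sr+qi * si) * pr-(qi * sr-qr * si) * pj)"
   and "D * ri = v * (m1 * pj-t1 * pr)+u * (qr * t2+qi * m2)
     -((m1 * sr+t1 * si) * t2+(m1 * si-t1 * sr) * m2) - ((qr * sr+qi * si) * pj+(qi * sr-qr * si) * pr)"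
  shows "N * (2 * (m1+m2)^2+2 * (u+v) * (E1+E2)-2 * (t1-t2)^2-(pr-qr)^2-(pj-qi)^2) =
     N/2 * (2 * m1+2 * m2)^2+N/2 * (A+B+2 * dd)+2 * (u^2 * B+v^2 * A-2 * u * v * dd)
     + 1/2 * (ua+va-v * (2 * m1)-u * (2 * m2))^2-1/4 * (ua-va-v * (2 * m1)+u * (2 * m2))^2
     + (4 * v * t1+4 * u * t2+2 * si * (pr-qr)-2 * sr * (pj-qi))^2" (is "?L = ?R")
proof -
  \<comment> \<open>The products of two differentials \<open>E1\<close>, \<open>E2\<close>,
    \<open>rr\<close>, \<open>ri\<close> enter \<open>?L - ?R\<close> with coefficients 8vD, 8uD,
    -16 sr D, -16 si D, because 2N - 8uv = 8D. This determines the multipliers of the four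
    relations.\<close>
  have "?L - ?R = 8 * v * (D * E1 - (v * (m1^2+t1^2)+u * (qr^2+qi^2)-2 * ((m1 * sr+t1 * si) * qr+(m1 * si-t1 * sr) * qi)))
    + 8 * u * (D * E2 - (u * (m2^2+t2^2)+v * (pr^2+pj^2)-2 * ((m2 * sr-t2 * si) * pr+(m2 * si+t2 * sr) * pj)))
    - 16 * sr * (D * rr - (v * (m1 * pr+t1 * pj)+u * (qr * m2-qi * t2)
     -((m1 * sr+t1 * si) * m2-(m1 * si-t1 * sr) * t2) - ((qr * sr+qi * si) * pr-(qi * sr-qr * si) * pj)))
    - 16 * si * (D * ri - (v * (m1 * pj-t1 * pr)+u * (qr * t2+qi * m2)
     -((m1 * sr+t1 * si) * t2+(m1 * si-t1 * sr) * m2) - ((qr * sr+qi * si) * pj+(qi * sr-qr * si) * pr)))"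
    unfolding assms(1-8) by algebra
  thus ?thesis unfolding assms(9-12) by simp
qed

subsection \<open>The quotient map and the metric upstairs\<close>

lemma UNIV_8: "(UNIV :: 8 set) = {0,1,2,3,4,5,6,7}"
proof -
  have "card {0,1,2,3,4,5,6,7::8} = CARD(8)" by simp
  thus ?thesis by (metis card_subset_eq finite subset_UNIV)
qed
lemma sum_8: "sum f (UNIV :: 8 set) = f 0 + f 1 + f 2 + f 3 + f 4 + f 5 + f 6 + f 7"
  unfolding UNIV_8 by (simp add: add.assoc)

lemma has_derivative_vector_3:
  assumes "(f1 has_derivative f1') (at x)" "(f2 has_derivative f2') (at x)" "(f3 has_derivative f3') (at x)"
  shows "((\<lambda>x. vector [f1 x, f2 x, f3 x] :: real^3) has_derivative
           (\<lambda>a. vector [f1' a, f2' a, f3' a])) (at x)"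
  using assms by (subst has_derivative_componentwise_within)
    (simp add: Basis_vec_def forall_3 inner_axis)

definition dQ :: "real^8 \<Rightarrow> real^8 \<Rightarrow> M_space" where
  "dQ x a = 2 *\<^sub>R
    (vector [x$0 * a$0 + x$1 * a$1 - x$4 * a$4 - x$5 * a$5,
             x$0 * a$4 + x$4 * a$0 + x$1 * a$5 + x$5 * a$1,
             x$0 * a$5 + x$5 * a$0 - x$1 * a$4 - x$4 * a$1],
     vector [x$2 * a$2 + x$3 * a$3 - x$6 * a$6 - x$7 * a$7,
             x$2 * a$6 + x$6 * a$2 + x$3 * a$7 + x$7 * a$3,
             x$2 * a$7 + x$7 * a$2 - x$3 * a$6 - x$6 * a$3])"

lemma scaleR_vector_3: "r *\<^sub>R (vector [a, b, c] :: real^3) = vector [r * a, r * b, r * c]"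
  by (simp add: vec_eq_iff forall_3)

lemma has_derivative_vec_nth: "((\<lambda>x. x $ i) has_derivative (\<lambda>a. a $ i)) (at x)"
  by (rule bounded_linear_imp_has_derivative) (rule bounded_linear_vec_nth)

lemma Qmap_has_derivative: "(Qmap has_derivative dQ x) (at x)"
  unfolding Qmap_def[abs_def] dQ_def[abs_def] scaleR_Pair scaleR_vector_3
  by (intro has_derivative_Pair has_derivative_vector_3)
    (auto intro!: derivative_eq_intros has_derivative_vec_nth simp: fun_eq_iff algebra_simps)

lemma R8_inner: "R8 x = x \<bullet> x"
  by (simp add: R8_def inner_vec_def power2_eq_square)

lemma eucl_inner: "eucl x a b = a \<bullet> b"
  by (simp add: eucl_def inner_vec_def)

lemma differential_R8: "differential R8 x a = 2 * (x \<bullet> a)"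
proof -
  have "(R8 has_derivative (\<lambda>a. 2 * (x \<bullet> a))) (at x)"
    unfolding R8_inner[abs_def] by (auto intro!: derivative_eq_intros simp: inner_commute)
  thus ?thesis by (simp add: differential_eq)
qed

lemma h_inner:
  "h c x a b = 2 * (x \<bullet> a) * (x \<bullet> b) + 2 * (x \<bullet> x) * (a \<bullet> b)
     - 2 * (Y1_field x \<bullet> a) * (Y1_field x \<bullet> b)
     + (1 - c) * ((Y2_field x \<bullet> a) * (Y2_field x \<bullet> b) + (Y3_field x \<bullet> a) * (Y3_field x \<bullet> b))"
  by (simp add: h_def tensor_prod_def differential_R8 R8_inner alpha1_def alpha2_def alpha3_def eucl_inner)

lemma h_commute: "h c x a b = h c x b a"
  by (simp add: h_inner inner_commute mult.commute mult.left_commute)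

lemma bilinear_h: "bilinear (h c x)"
  unfolding bilinear_def linear_iff h_inner by (simp add: inner_simps algebra_simps)

lemma inner_8: "(a :: real^8) \<bullet> b = a$0 * b$0 + a$1 * b$1 + a$2 * b$2 + a$3 * b$3
    + a$4 * b$4 + a$5 * b$5 + a$6 * b$6 + a$7 * b$7"
  by (simp add: inner_vec_def sum_8)

lemma field_inner:
  "X_field x \<bullet> a = x$0 * a$1 - x$1 * a$0 + x$2 * a$3 - x$3 * a$2
     + x$4 * a$5 - x$5 * a$4 + x$6 * a$7 - x$7 * a$6"
  "Y1_field x \<bullet> a = x$0 * a$1 - x$1 * a$0 - x$2 * a$3 + x$3 * a$2
     + x$4 * a$5 - x$5 * a$4 - x$6 * a$7 + x$7 * a$6"
  "Y2_field x \<bullet> a = x$0 * a$2 - x$2 * a$0 + x$1 * a$3 - x$3 * a$1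
     + x$4 * a$6 - x$6 * a$4 + x$5 * a$7 - x$7 * a$5"
  "Y3_field x \<bullet> a = x$0 * a$3 - x$3 * a$0 + x$2 * a$1 - x$1 * a$2
     + x$4 * a$7 - x$7 * a$4 + x$6 * a$5 - x$5 * a$6"
  by (simp_all add: X_field_def Y1_field_def Y2_field_def Y3_field_def inner_simps inner_axis' algebra_simps)

lemma X_field_nth:
  "X_field x $ 0 = - x$1" "X_field x $ 1 = x$0" "X_field x $ 2 = - x$3" "X_field x $ 3 = x$2"
  "X_field x $ 4 = - x$5" "X_field x $ 5 = x$4" "X_field x $ 6 = - x$7" "X_field x $ 7 = x$6"
  by (simp_all add: X_field_def axis_def)

text \<open>The Hopf map squares lengths: the squares of its components add up to |psi|^4, whose
  nonnegative root is |psi|^2.\<close>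

lemma ulen_Qmap: "ulen (Qmap x) = (x$0)\<^sup>2 + (x$1)\<^sup>2 + (x$4)\<^sup>2 + (x$5)\<^sup>2"
  and vlen_Qmap: "vlen (Qmap x) = (x$2)\<^sup>2 + (x$3)\<^sup>2 + (x$6)\<^sup>2 + (x$7)\<^sup>2"
proof -
  show "ulen (Qmap x) = (x$0)\<^sup>2 + (x$1)\<^sup>2 + (x$4)\<^sup>2 + (x$5)\<^sup>2"
    unfolding ulen_def norm_eq_sqrt_inner
    by (rule real_sqrt_unique) (simp_all add: uvec_def Qmap_def inner_vec_def sum_3, algebra)
  show "vlen (Qmap x) = (x$2)\<^sup>2 + (x$3)\<^sup>2 + (x$6)\<^sup>2 + (x$7)\<^sup>2"
    unfolding vlen_def norm_eq_sqrt_inner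
    by (rule real_sqrt_unique) (simp_all add: vvec_def Qmap_def inner_vec_def sum_3, algebra)
qed

text \<open>On X the products with x, X, \<open>Y1_field\<close> are 0, u + v, u - v, and those with
  \<open>Y2_field\<close>, \<open>Y3_field\<close> have squares adding up to 4|sigma|^2. Hence
  h_2(X,X) = 8uv - 4|sigma|^2, and 2|sigma|^2 is uv plus the inner product of the vectors u and
  v.\<close>

lemma Nc_2: "Nc 2 x = 6 * ulen (Qmap x) * vlen (Qmap x) - 2 * (uvec (Qmap x) \<bullet> vvec (Qmap x))"
  unfolding Nc_def h_inner field_inner unfolding inner_8 X_field_nth ulen_Qmap vlen_Qmap
  by (simp add: uvec_def vvec_def Qmap_def inner_vec_def sum_3, algebra)

subsection \<open>The candidate metric is Riemannian\<close>

definition N_M :: "M_space \<Rightarrow> real" where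
  "N_M p = 6 * ulen p * vlen p - 2 * (uvec p \<bullet> vvec p)"

definition g2 :: "M_space tensor2" where
  "g2 p a b =
     1/2 * tensor_sq (differential RM) p a b
     + 1/2 * norm_sq_form (\<lambda>q w. differential uvec q w + differential vvec q w) p a b
     + 2 / N_M p * norm_sq_form B_form p a b
     + 1 / (2 * N_M p) * tensor_sq Gamma_plus p a b
     - 1 / (4 * N_M p) * tensor_sq Gamma_minus p a b"

text \<open>On \<open>M_reg\<close> these are the differentials of the lengths \<open>ulen\<close>
  and \<open>vlen\<close>, not of the vectors.\<close>

definition du :: "M_space oneform" where "du p a = (fst p \<bullet> fst a) / ulen p"
definition dv :: "M_space oneform" where "dv p a = (snd p \<bullet> snd a) / vlen p"

lemma differential_uvec: "differential uvec p a = fst a"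
  and differential_vvec: "differential vvec p a = snd a"
proof -
  have "(uvec has_derivative fst) (at p)" "(vvec has_derivative snd) (at p)"
    unfolding uvec_def[abs_def] vvec_def[abs_def] by (auto intro!: derivative_eq_intros)
  thus "differential uvec p a = fst a" "differential vvec p a = snd a"
    by (simp_all add: differential_eq)
qed

lemma M_reg_pos: "p \<in> M_reg \<Longrightarrow> ulen p > 0" "p \<in> M_reg \<Longrightarrow> vlen p > 0"
  by (auto simp: M_reg_def ulen_def vlen_def)

lemma differential_RM:
  assumes "p \<in> M_reg"
  shows "differential RM p a = du p a + dv p a"
proof -
  have "fst p \<noteq> 0" "snd p \<noteq> 0"
    using assms by (auto simp: M_reg_def ulen_def vlen_def uvec_def vvec_def)
  hence "(RM has_derivative (\<lambda>a. fst a \<bullet> sgn (fst p) + snd a \<bullet> sgn (snd p))) (at p)"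
    unfolding RM_def[abs_def] ulen_def vlen_def uvec_def vvec_def
    by (auto intro!: has_derivative_add has_derivative_compose[OF _ has_derivative_norm]
        has_derivative_fst has_derivative_snd)
  thus ?thesis
    by (simp add: differential_eq du_def dv_def ulen_def vlen_def uvec_def vvec_def sgn_div_norm divide_inverse
        inner_commute)
qed

lemma B_form_eq: "B_form p a = ulen p *\<^sub>R snd a - vlen p *\<^sub>R fst a"
  by (simp add: B_form_def differential_uvec differential_vvec)

text \<open>Once the inner products of each vector with its own differential are written as
  \<open>ulen\<close> times \<open>du\<close> and \<open>vlen\<close> times \<open>dv\<close>, the
  factor uv cancels against the denominator.\<close>

lemma Gamma_eq:
  assumes "p \<in> M_reg"
  shows "Gamma_plus p a = fst p \<bullet> snd a + snd p \<bullet> fst a - vlen p * du p a - ulen p * dv p a"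
    and "Gamma_minus p a = fst p \<bullet> snd a - snd p \<bullet> fst a - vlen p * du p a + ulen p * dv p a"
  using M_reg_pos[OF assms]
  by (simp_all add: Gamma_plus_def Gamma_minus_def A_plus_def A_minus_def B_form_eq du_def dv_def
      uvec_def vvec_def inner_simps field_simps)

lemma g2_eq:
  assumes "p \<in> M_reg"
  shows "g2 p a b = 1/2 * ((du p a + dv p a) * (du p b + dv p b))
     + 1/2 * ((fst a + snd a) \<bullet> (fst b + snd b))
     + 2 / N_M p * ((ulen p *\<^sub>R snd a - vlen p *\<^sub>R fst a) \<bullet> (ulen p *\<^sub>R snd b - vlen p *\<^sub>R fst b))
     + 1 / (2 * N_M p) * ((fst p \<bullet> snd a + snd p \<bullet> fst a - vlen p * du p a - ulen p * dv p a)
          * (fst p \<bullet> snd b + snd p \<bullet> fst b - vlen p * du p b - ulen p * dv p b))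
     - 1 / (4 * N_M p) * ((fst p \<bullet> snd a - snd p \<bullet> fst a - vlen p * du p a + ulen p * dv p a)
          * (fst p \<bullet> snd b - snd p \<bullet> fst b - vlen p * du p b + ulen p * dv p b))"
  by (simp add: g2_def tensor_prod_def norm_sq_form_def differential_RM[OF assms]
      differential_uvec differential_vvec B_form_eq Gamma_eq[OF assms])

lemma g2_commute: "g2 p a b = g2 p b a"
  by (simp add: g2_def tensor_prod_def norm_sq_form_def inner_commute mult.commute mult.left_commute)

text \<open>Cauchy-Schwarz gives N \<ge> 4uv.\<close>

lemma N_M_pos:
  assumes "p \<in> M_reg"
  shows "N_M p > 0"
proof -
  have "uvec p \<bullet> vvec p \<le> ulen p * vlen p"
    unfolding ulen_def vlen_def by (rule norm_cauchy_schwarz)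
  moreover have "ulen p * vlen p > 0" using M_reg_pos[OF assms] by simp
  ultimately show ?thesis unfolding N_M_def by linarith
qed

text \<open>Covers each term of \<open>g2\<close> as well as the product of h_2(X,.) with itself:
  for real-valued \<open>f\<close> the inner product is multiplication.\<close>

lemma bilinear_rank_one:
  fixes f :: "'a::real_vector \<Rightarrow> 'b::real_inner"
  assumes "linear f"
  shows "bilinear (\<lambda>a b. c * (f a \<bullet> f b))"
  using assms by (auto simp: bilinear_def linear_iff inner_simps distrib_left)

lemma bilinear_add:
  "bilinear f \<Longrightarrow> bilinear g \<Longrightarrow> bilinear (\<lambda>a b. f a b + g a b)"
  unfolding bilinear_def by (auto intro: linear_compose_add)

lemma bilinear_g2:
  assumes "p \<in> M_reg"
  shows "bilinear (g2 p)"
proof -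
  have du: "linear (du p)" "linear (dv p)"
    by (auto simp: linear_iff du_def dv_def inner_simps add_divide_distrib)
  have "linear (differential RM p)"
    unfolding differential_RM[OF assms, abs_def] by (intro linear_compose_add du)
  moreover have "linear (\<lambda>w. differential uvec p w + differential vvec p w)"
    unfolding differential_uvec differential_vvec by (intro linear_compose_add linear_fst linear_snd)
  moreover have B: "linear (B_form p)"
    unfolding B_form_eq[abs_def]
    by (intro linear_compose_sub linear_compose_scale_right linear_fst linear_snd)
  moreover have "linear (Gamma_plus p)" "linear (Gamma_minus p)"
    unfolding Gamma_plus_def[abs_def] Gamma_minus_def[abs_def] linear_iff
      linear_add[OF B] linear_scale[OF B] by (simp_all add: inner_simps distrib_left)
  ultimately show ?thesis
    using bilinear_add[OF bilinear_add[OF bilinear_add[OF bilinear_add]],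
        OF bilinear_rank_one bilinear_rank_one bilinear_rank_one bilinear_rank_one bilinear_rank_one,
        of "differential RM p" "\<lambda>w. differential uvec p w + differential vvec p w" "B_form p"
          "Gamma_plus p" "Gamma_minus p" "1/2" "1/2" "2 / N_M p" "1 / (2 * N_M p)" "- (1 / (4 * N_M p))"]
    by (simp add: g2_def[abs_def] tensor_prod_def norm_sq_form_def)
qed

text \<open>
  The negative term is absorbed by half of the $|\mathbf B|^2$ term: $|\mathbf A_-| \le 2uv$ gives
  $\Gamma_-^2 \le 4 |\mathbf B|^2$.
\<close>

lemma g2_pos:
  assumes p: "p \<in> M_reg" and "a \<noteq> 0"
  shows "g2 p a a > 0"
proof -
  note pos = M_reg_pos[OF p] N_M_pos[OF p]
  have "norm (A_minus p) \<le> 2 * (ulen p * vlen p)"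
    using norm_triangle_ineq[of "vlen p *\<^sub>R uvec p" "ulen p *\<^sub>R vvec p"]
    by (simp add: A_minus_def ulen_def vlen_def mult.commute)
  hence "\<bar>A_minus p \<bullet> B_form p a\<bar> \<le> 2 * (ulen p * vlen p) * norm (B_form p a)"
    by (rule order_trans[OF Cauchy_Schwarz_ineq2 mult_right_mono]) simp
  hence "\<bar>Gamma_minus p a\<bar> \<le> 2 * norm (B_form p a)"
    using pos by (simp add: Gamma_minus_def abs_mult field_simps)
  hence "\<bar>Gamma_minus p a\<bar>\<^sup>2 \<le> (2 * norm (B_form p a))\<^sup>2"
    by (rule power_mono) simp
  hence "(Gamma_minus p a)\<^sup>2 \<le> 4 * (B_form p a \<bullet> B_form p a)"
    by (simp add: power_mult_distrib power2_norm_eq_inner)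
  hence "(Gamma_minus p a)\<^sup>2 / (4 * N_M p) \<le> 4 * (B_form p a \<bullet> B_form p a) / (4 * N_M p)"
    using pos by (intro divide_right_mono) auto
  also have "\<dots> = (B_form p a \<bullet> B_form p a) / N_M p"
    by simp
  finally have "(Gamma_minus p a)\<^sup>2 / (4 * N_M p) \<le> (B_form p a \<bullet> B_form p a) / N_M p" .
  moreover have "(Gamma_plus p a)\<^sup>2 / (2 * N_M p) \<ge> 0" "(differential RM p a)\<^sup>2 / 2 \<ge> 0"
    using pos by simp_all
  moreover have "g2 p a a = (differential RM p a)\<^sup>2 / 2 + 1/2 * ((fst a + snd a) \<bullet> (fst a + snd a))
      + 2 * ((B_form p a \<bullet> B_form p a) / N_M p) + (Gamma_plus p a)\<^sup>2 / (2 * N_M p)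
      - (Gamma_minus p a)\<^sup>2 / (4 * N_M p)"
    by (simp add: g2_def tensor_prod_def norm_sq_form_def differential_uvec differential_vvec
        power2_eq_square)
  ultimately have "g2 p a a \<ge> 1/2 * ((fst a + snd a) \<bullet> (fst a + snd a))
      + (B_form p a \<bullet> B_form p a) / N_M p"
    by linarith
  moreover have "1/2 * ((fst a + snd a) \<bullet> (fst a + snd a)) + (B_form p a \<bullet> B_form p a) / N_M p > 0"
  \<comment> \<open>The two terms cannot both vanish: a vector of the form (w, -w) has
    \<open>B_form\<close> equal to -(u + v) w, which is nonzero for w \<noteq> 0.\<close>
  proof (cases "fst a + snd a = 0")
    case True
    hence s: "snd a = - fst a" by (simp add: add_eq_0_iff)
    hence "fst a \<noteq> 0" using assms(2) by (auto simp: prod_eq_iff)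
    moreover have "B_form p a = - (ulen p + vlen p) *\<^sub>R fst a"
      by (simp add: B_form_eq s algebra_simps)
    ultimately have "B_form p a \<noteq> 0" using pos by simp
    thus ?thesis using pos by (simp add: add_nonneg_pos)
  next
    case False
    thus ?thesis using pos by (simp add: add_pos_nonneg)
  qed
  ultimately show ?thesis by linarith
qed

section \<open>Smoothness of the candidate metric\<close>

lemma open_M_reg: "open M_reg"
  unfolding M_reg_def ulen_def vlen_def uvec_def vvec_def
  by (intro open_Collect_neq continuous_intros)

lemma Cinf_on_nth: "Cinf_on M_reg (\<lambda>p. fst p $ i)" "Cinf_on M_reg (\<lambda>p. snd p $ i)"
  by (auto intro!: Cinf_on_bounded_linear bounded_linear_vec_nth[THEN bounded_linear_compose]
      bounded_linear_fst bounded_linear_snd)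

lemma Cinf_on_ulen: "Cinf_on M_reg ulen" and Cinf_on_vlen: "Cinf_on M_reg vlen"
proof -
  have eq: "ulen = (\<lambda>p. sqrt (\<Sum>i\<in>UNIV. fst p $ i * fst p $ i))"
    "vlen = (\<lambda>p. sqrt (\<Sum>i\<in>UNIV. snd p $ i * snd p $ i))"
    by (simp_all add: ulen_def vlen_def uvec_def vvec_def norm_eq_sqrt_inner inner_vec_def fun_eq_iff)
  have "0 < (\<Sum>i\<in>UNIV. fst p $ i * fst p $ i)" "0 < (\<Sum>i\<in>UNIV. snd p $ i * snd p $ i)"
    if "p \<in> M_reg" for p
    using M_reg_pos[OF that] unfolding eq by simp_all
  thus "Cinf_on M_reg ulen" "Cinf_on M_reg vlen"
    unfolding eq by (intro Cinf_on_sqrt Cinf_on_sum Cinf_on_mult open_M_reg Cinf_on_nth; simp)+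
qed

lemma Cinf_on_inner_const:
  "Cinf_on M_reg (\<lambda>p. fst p \<bullet> w)" "Cinf_on M_reg (\<lambda>p. snd p \<bullet> w)"
  by (auto intro!: Cinf_on_bounded_linear bounded_linear_inner_left_comp bounded_linear_fst bounded_linear_snd)

lemma Cinf_on_N_M: "Cinf_on M_reg N_M"
  unfolding N_M_def[abs_def] uvec_def vvec_def inner_vec_def inner_real_def
  by (intro Cinf_on_diff Cinf_on_mult Cinf_on_sum open_M_reg Cinf_on_ulen Cinf_on_vlen
      Cinf_on_const Cinf_on_nth)

lemma Cinf_on_g2: "Cinf_on M_reg (\<lambda>p. g2 p a b)"
proof -
  have nz: "ulen p \<noteq> 0" "vlen p \<noteq> 0" "N_M p \<noteq> 0" "2 * N_M p \<noteq> 0" "4 * N_M p \<noteq> 0" if "p \<in> M_reg" for p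
    using M_reg_pos[OF that] N_M_pos[OF that] by auto
  have d: "Cinf_on M_reg (\<lambda>p. du p w)" "Cinf_on M_reg (\<lambda>p. dv p w)" for w
    unfolding du_def dv_def
    by (intro Cinf_on_divide open_M_reg Cinf_on_inner_const Cinf_on_ulen Cinf_on_vlen nz; assumption)+
  show ?thesis
    \<comment> \<open>Once the inner products are expanded, the explicit formula depends on the
      point only through \<open>ulen\<close>, \<open>vlen\<close>, \<open>N_M\<close>,
      \<open>du\<close>, \<open>dv\<close> and inner products with constant vectors, all of them
      smooth on \<open>M_reg\<close>.\<close>
    apply (subst Cinf_on_cong[OF open_M_reg g2_eq], assumption)
    unfolding inner_diff_left inner_diff_right
      inner_scaleR_left inner_scaleR_right
    by (intro Cinf_on_add Cinf_on_diff Cinf_on_mult Cinf_on_divide open_M_reg Cinf_on_const d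
        Cinf_on_inner_const Cinf_on_ulen Cinf_on_vlen Cinf_on_N_M nz; assumption)
qed

subsection \<open>The candidate metric is the pushdown\<close>

text \<open>Polarisation: it reduces the comparison of two symmetric forms to a single tangent
  vector.\<close>

lemma bilinear_eqI:
  fixes f g :: "'a::real_vector \<Rightarrow> 'a \<Rightarrow> real"
  assumes "bilinear f" "bilinear g" and "\<And>a b. f a b = f b a" "\<And>a b. g a b = g b a"
    and eq: "\<And>a. f a a = g a a"
  shows "f a b = g a b"
proof -
  have "F (a + b) (a + b) = F a a + F b b + 2 * F a b" if "bilinear F" "\<And>a b. F a b = F b a"
    for F :: "'a \<Rightarrow> 'a \<Rightarrow> real"
    using that(2)[of b a] by (simp add: bilinear_ladd[OF that(1)] bilinear_radd[OF that(1)])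
  from this[of f] this[of g] show ?thesis
    using assms(1-4) eq[of "a + b"] eq[of a] eq[of b] by simp
qed

text \<open>All parts are polarisations of one fact: the Hopf images of z and w have inner product
  2|<z,w>|^2 - |z|^2 |w|^2. With \<open>a\<close> the pair (dpsi, dphi), \<open>r x a\<close> and
  \<open>s x a\<close> are the real and imaginary parts of <psi,dphi>, and \<open>r a x\<close>,
  \<open>s a x\<close> those of <dpsi,phi>.\<close>

lemma dQ_inner:
  defines "m1 \<equiv> \<lambda>x a. x$0 * a$0 + x$1 * a$1 + x$4 * a$4 + x$5 * (a$5::real)"
    and "t1 \<equiv> \<lambda>x a. x$0 * a$1 - x$1 * a$0 + x$4 * a$5 - x$5 * (a$4::real)"
    and "m2 \<equiv> \<lambda>x a. x$2 * a$2 + x$3 * a$3 + x$6 * a$6 + x$7 * (a$7::real)"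
    and "t2 \<equiv> \<lambda>x a. x$2 * a$3 - x$3 * a$2 + x$6 * a$7 - x$7 * (a$6::real)"
    and "r \<equiv> \<lambda>x a. x$0 * a$2 + x$1 * a$3 + x$4 * a$6 + x$5 * (a$7::real)"
    and "s \<equiv> \<lambda>x a. x$0 * a$3 - x$1 * a$2 + x$4 * a$7 - x$5 * (a$6::real)"
  shows "fst (Qmap x) \<bullet> snd (Qmap x) = 2 * ((r x x)\<^sup>2 + (s x x)\<^sup>2) - ulen (Qmap x) * vlen (Qmap x)"
    and "fst (Qmap x) \<bullet> fst (dQ x a) = ulen (Qmap x) * (2 * m1 x a)"
    and "snd (Qmap x) \<bullet> snd (dQ x a) = vlen (Qmap x) * (2 * m2 x a)"
    and "fst (Qmap x) \<bullet> snd (dQ x a) = 4 * (r x x * r x a + s x x * s x a) - 2 * ulen (Qmap x) * m2 x a"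
    and "snd (Qmap x) \<bullet> fst (dQ x a) = 4 * (r x x * r a x + s x x * s a x) - 2 * vlen (Qmap x) * m1 x a"
    and "fst (dQ x a) \<bullet> fst (dQ x a) = 4 * ulen (Qmap x) * m1 a a - 4 * (t1 x a)\<^sup>2"
    and "snd (dQ x a) \<bullet> snd (dQ x a) = 4 * vlen (Qmap x) * m2 a a - 4 * (t2 x a)\<^sup>2"
    and "fst (dQ x a) \<bullet> snd (dQ x a) = 4 * (r x x * r a a + s x x * s a a)
           + 4 * (r x a * r a x + s x a * s a x) - 4 * m1 x a * m2 x a"
  unfolding assms ulen_Qmap vlen_Qmap
  by (simp_all add: dQ_def Qmap_def inner_vec_def sum_3, algebra+)

text \<open>By polarisation one tangent vector suffices; multiplied by N, the equation becomes
  \<open>hermitian_identity\<close>, whose hypotheses hold because psi, phi, dpsi, dphi lie in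
  C^2.\<close>

lemma h_eq_g2:
  assumes "Qmap x \<in> M_reg"
  shows "h 2 x a b = g2 (Qmap x) (dQ x a) (dQ x b) + h 2 x (X_field x) a * h 2 x (X_field x) b / N_M (Qmap x)"
proof -
  note pos = M_reg_pos[OF assms] N_M_pos[OF assms]
  have diag: "h 2 x a a = g2 (Qmap x) (dQ x a) (dQ x a) + h 2 x (X_field x) a * h 2 x (X_field x) a / N_M (Qmap x)" for a
  proof -
    \<comment> \<open>In complex terms \<open>m1 + i t1\<close> = <psi,dpsi>,
      \<open>m2 + i t2\<close> = <phi,dphi>, \<open>pr + i pj\<close> = <psi,dphi>,
      \<open>qr + i qi\<close> = <dpsi,phi>, \<open>rr + i ri\<close> = <dpsi,dphi>, while
      \<open>E1\<close> and \<open>E2\<close> are |dpsi|^2 and |dphi|^2.\<close>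
    define u v where "u = ulen (Qmap x)" and "v = vlen (Qmap x)"
    define sr where "sr = x$0 * x$2 + x$1 * x$3 + x$4 * x$6 + x$5 * x$7"
    define si where "si = x$0 * x$3 - x$1 * x$2 + x$4 * x$7 - x$5 * x$6"
    define m1 where "m1 = x$0 * a$0 + x$1 * a$1 + x$4 * a$4 + x$5 * a$5"
    define t1 where "t1 = x$0 * a$1 - x$1 * a$0 + x$4 * a$5 - x$5 * a$4"
    define m2 where "m2 = x$2 * a$2 + x$3 * a$3 + x$6 * a$6 + x$7 * a$7"
    define t2 where "t2 = x$2 * a$3 - x$3 * a$2 + x$6 * a$7 - x$7 * a$6"
    define pr where "pr = x$0 * a$2 + x$1 * a$3 + x$4 * a$6 + x$5 * a$7"
    define qi where "qi = a$0 * x$3 - a$1 * x$2 + a$4 * x$7 - a$5 * x$6"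
    define qr where "qr = a$0 * x$2 + a$1 * x$3 + a$4 * x$6 + a$5 * x$7"
    define pj where "pj = x$0 * a$3 - x$1 * a$2 + x$4 * a$7 - x$5 * a$6"
    define E1 where "E1 = a$0 * a$0 + a$1 * a$1 + a$4 * a$4 + a$5 * a$5"
    define E2 where "E2 = a$2 * a$2 + a$3 * a$3 + a$6 * a$6 + a$7 * a$7"
    define rr where "rr = a$0 * a$2 + a$1 * a$3 + a$4 * a$6 + a$5 * a$7"
    define ri where "ri = a$0 * a$3 - a$1 * a$2 + a$4 * a$7 - a$5 * a$6"
    note defs = m1_def t1_def m2_def t2_def pr_def qr_def pj_def qi_def E1_def E2_def rr_def ri_def
    note dQs = dQ_inner(1)[of x, folded u_def v_def sr_def si_def]
      dQ_inner(2-)[of x a, folded u_def v_def sr_def si_def defs]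
    have u: "u = (x$0)\<^sup>2 + (x$1)\<^sup>2 + (x$4)\<^sup>2 + (x$5)\<^sup>2"
      and v: "v = (x$2)\<^sup>2 + (x$3)\<^sup>2 + (x$6)\<^sup>2 + (x$7)\<^sup>2"
      by (simp_all add: u_def v_def ulen_Qmap vlen_Qmap)
    have N: "N_M (Qmap x) = 6 * u * v - 2 * (2 * (sr\<^sup>2 + si\<^sup>2) - u * v)"
      by (simp add: N_M_def uvec_def vvec_def dQs u_def v_def)
    have du: "du (Qmap x) (dQ x a) = 2 * m1" "dv (Qmap x) (dQ x a) = 2 * m2"
      using pos by (simp_all add: du_def dv_def dQs u_def[symmetric] v_def[symmetric])
    have hX: "h 2 x (X_field x) a = 4 * v * t1 + 4 * u * t2 + 2 * si * (pr - qr) - 2 * sr * (pj - qi)"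
      unfolding h_inner field_inner unfolding inner_8 field_inner X_field_nth u v defs sr_def si_def
      by (simp, algebra)
    have h: "h 2 x a a = 2 * (m1+m2)^2+2 * (u+v) * (E1+E2)-2 * (t1-t2)^2-(pr-qr)^2-(pj-qi)^2"
      unfolding h_inner field_inner unfolding inner_8 u v defs sr_def si_def
      by (simp, algebra)
    have e1: "(u * v-sr^2-si^2) * E1 = v * (m1^2+t1^2)+u * (qr^2+qi^2)-2 * ((m1 * sr+t1 * si) * qr+(m1 * si-t1 * sr) * qi)"
      using gram_norm[of "x$0" "x$1" "x$4" "x$5" "x$2" "x$3" "x$6" "x$7" "a$0" "a$1" "a$4" "a$5"]
      unfolding u v defs sr_def si_def by (simp only: power2_eq_square)
    \<comment> \<open>This is the Gram relation with psi and phi exchanged, which conjugates sigma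
      and so flips the sign of \<open>si\<close>.\<close>
    have e2: "(u * v-sr^2-si^2) * E2 = u * (m2^2+t2^2)+v * (pr^2+pj^2)-2 * ((m2 * sr-t2 * si) * pr+(m2 * si+t2 * sr) * pj)"
      unfolding u v defs sr_def si_def by algebra
    \<comment> \<open>The positional arguments follow the order of occurrence in the expanded
      identities: the products a1 b1, a2 b2 of \<open>rr\<close> in the first and a1 b2, a2 b1 of
      \<open>ri\<close> in the second. Both are instances with dpsi and dphi for a and b.\<close>
    note er = gram_inner(1)[of "x$0" "x$1" "x$4" "x$5" "x$2" "x$3" "x$6" "x$7"
        "a$0" "a$2" "a$1" "a$3" "a$4" "a$6" "a$5" "a$7", folded u v defs sr_def si_def]
      gram_inner(2)[of "x$0" "x$1" "x$4" "x$5" "x$2" "x$3" "x$6" "x$7"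
        "a$0" "a$3" "a$1" "a$2" "a$4" "a$7" "a$5" "a$6", folded u v defs sr_def si_def]
    have "N_M (Qmap x) * h 2 x a a = N_M (Qmap x) * g2 (Qmap x) (dQ x a) (dQ x a) + (h 2 x (X_field x) a)^2"
    proof -
      define N where "N = N_M (Qmap x)"
      define A B dd where "A = 4 * u * E1 - 4 * t1\<^sup>2" and "B = 4 * v * E2 - 4 * t2\<^sup>2"
        and "dd = 4 * (sr * rr + si * ri) + 4 * (pr * qr + pj * qi) - 4 * m1 * m2"
      define ua va where "ua = 4 * (sr * pr + si * pj) - 2 * u * m2"
        and "va = 4 * (sr * qr + si * qi) - 2 * v * m1"
      note abbr = A_def B_def dd_def ua_def va_def
      have sum: "(fst (dQ x a) + snd (dQ x a)) \<bullet> (fst (dQ x a) + snd (dQ x a)) = A + B + 2 * dd"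
        by (simp add: inner_add_left inner_add_right inner_commute[of "snd (dQ x a)" "fst (dQ x a)"] dQs abbr)
      have "(u *\<^sub>R snd (dQ x a) - v *\<^sub>R fst (dQ x a)) \<bullet> (u *\<^sub>R snd (dQ x a) - v *\<^sub>R fst (dQ x a))
          = u\<^sup>2 * (snd (dQ x a) \<bullet> snd (dQ x a)) + v\<^sup>2 * (fst (dQ x a) \<bullet> fst (dQ x a))
            - 2 * u * v * (fst (dQ x a) \<bullet> snd (dQ x a))"
        by (simp add: inner_diff_left inner_diff_right inner_commute[of "snd (dQ x a)" "fst (dQ x a)"]
            power2_eq_square algebra_simps)
      hence diff: "(u *\<^sub>R snd (dQ x a) - v *\<^sub>R fst (dQ x a)) \<bullet> (u *\<^sub>R snd (dQ x a) - v *\<^sub>R fst (dQ x a))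
          = u\<^sup>2 * B + v\<^sup>2 * A - 2 * u * v * dd"
        by (simp add: dQs abbr)
      have "N * g2 (Qmap x) (dQ x a) (dQ x a) = N / 2 * (2 * m1 + 2 * m2)\<^sup>2 + N / 2 * (A + B + 2 * dd)
          + 2 * (u\<^sup>2 * B + v\<^sup>2 * A - 2 * u * v * dd)
          + 1/2 * (ua + va - v * (2 * m1) - u * (2 * m2))\<^sup>2
          - 1/4 * (ua - va - v * (2 * m1) + u * (2 * m2))\<^sup>2"
        unfolding g2_eq[OF assms] du u_def[symmetric] v_def[symmetric] sum diff
          dQs(4,5)[folded abbr] N_def[symmetric]
        using pos(3)[folded N_def] by (simp add: field_simps power2_eq_square)
      thus ?thesis
        using hermitian_identity[OF e1 e2 er] unfolding h hX N_def[symmetric] N[folded N_def] abbr by linarith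
    qed
    thus ?thesis using pos by (simp add: field_simps power2_eq_square)
  qed
  have lin: "linear (dQ x)"
    using Qmap_has_derivative has_derivative_linear by blast
  have hl: "linear (h 2 x (X_field x))"
    using bilinear_h unfolding bilinear_def by blast
  have "bilinear (\<lambda>a b. g2 (Qmap x) (dQ x a) (dQ x b))"
    using bilinear_g2[OF assms] linear_compose[OF lin] unfolding bilinear_def o_def by blast
  from bilinear_add[OF this bilinear_rank_one[OF hl, of "1 / N_M (Qmap x)"]]
  have bil: "bilinear (\<lambda>a b. g2 (Qmap x) (dQ x a) (dQ x b)
      + h 2 x (X_field x) a * h 2 x (X_field x) b / N_M (Qmap x))"
    by simp
  show ?thesis
    by (rule bilinear_eqI[where f = "h 2 x", OF bilinear_h bil h_commute])
      (simp add: g2_commute mult.commute, rule diag)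
qed

section \<open>Surjectivity of the quotient map and of its differential\<close>

lemma vec_8_obtain:
  obtains x :: "real^8" where "x$0 = c0" "x$1 = c1" "x$2 = c2" "x$3 = c3"
    "x$4 = c4" "x$5 = c5" "x$6 = c6" "x$7 = c7"
  by (rule that[of "c0 *\<^sub>R pd 0 + c1 *\<^sub>R pd 1 + c2 *\<^sub>R pd 2 + c3 *\<^sub>R pd 3
      + c4 *\<^sub>R pd 4 + c5 *\<^sub>R pd 5 + c6 *\<^sub>R pd 6 + c7 *\<^sub>R pd 7"])
    (simp_all add: axis_def)

text \<open>Rotating along the Hopf circle makes the first complex coordinate a real z \<ge> 0 with
  z^2 = (r + w1)/2; then w2 = 2 z z3 and w3 = 2 z z4 determine the second when z > 0.\<close>

lemma hopf_map_surj:
  fixes w :: "real^3"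
  obtains z1 z2 z3 z4 :: real where
    "vector [z1\<^sup>2 + z2\<^sup>2 - z3\<^sup>2 - z4\<^sup>2, 2 * (z1 * z3 + z2 * z4), 2 * (z1 * z4 - z2 * z3)] = w"
proof -
  define r where "r = norm w"
  have r2: "r\<^sup>2 = (w$1)\<^sup>2 + (w$2)\<^sup>2 + (w$3)\<^sup>2"
    unfolding r_def power2_norm_eq_inner by (simp add: inner_vec_def sum_3 power2_eq_square)
  have "\<bar>w$1\<bar> \<le> r" unfolding r_def by (rule component_le_norm_cart)
  show thesis
  proof (cases "r + w$1 = 0")
    \<comment> \<open>On the half-line w = (-r, 0, 0) the first complex coordinate must vanish, so
      division by z is impossible and the preimage is given directly.\<close>
    case True
    hence w1: "w$1 = - r" by simp
    hence "(w$2)\<^sup>2 + (w$3)\<^sup>2 = 0" using r2 by simp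
    hence "w$2 = 0" "w$3 = 0" by (simp_all add: sum_power2_eq_zero_iff)
    thus thesis
      using w1 by (intro that[of 0 0 "sqrt r" 0]) (simp add: vec_eq_iff forall_3 r_def)
  next
    case False
    hence pos: "r + w$1 > 0" using \<open>\<bar>w$1\<bar> \<le> r\<close> by linarith
    define z where "z = sqrt ((r + w$1) / 2)"
    have z: "z > 0" "z\<^sup>2 = (r + w$1) / 2" using pos by (simp_all add: z_def)
    have "(w$2 / (2 * z))\<^sup>2 + (w$3 / (2 * z))\<^sup>2 = ((w$2)\<^sup>2 + (w$3)\<^sup>2) / (4 * z\<^sup>2)"
      by (simp add: power_divide power_mult_distrib add_divide_distrib)
    also have "(w$2)\<^sup>2 + (w$3)\<^sup>2 = (r + w$1) * (r - w$1)"
      using r2 by (simp add: power2_eq_square algebra_simps)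
    also have "\<dots> / (4 * z\<^sup>2) = (r - w$1) / 2"
    proof -
      have "k * m / (4 * (k / 2)) = m / 2" if "k > 0" for k m :: real using that by simp
      from this[OF pos] show ?thesis unfolding z(2) .
    qed
    finally have sum: "(w$2 / (2 * z))\<^sup>2 + (w$3 / (2 * z))\<^sup>2 = (r - w$1) / 2" .
    have "c + 0\<^sup>2 - d - e = w$1" if "d + e = (r - w$1) / 2" "c = (r + w$1) / 2" for c d e :: real
      using that by (simp add: field_simps)
    from this[OF sum z(2)] have "z\<^sup>2 + 0\<^sup>2 - (w$2 / (2 * z))\<^sup>2 - (w$3 / (2 * z))\<^sup>2 = w$1" .
    thus thesis
      using z(1) by (intro that[of z 0 "w$2 / (2 * z)" "w$3 / (2 * z)"]) (simp add: vec_eq_iff forall_3)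
  qed
qed

lemma Qmap_surj: obtains x where "Qmap x = p"
proof -
  obtain z1 z2 z3 z4 where z:
    "vector [z1\<^sup>2 + z2\<^sup>2 - z3\<^sup>2 - z4\<^sup>2, 2 * (z1 * z3 + z2 * z4), 2 * (z1 * z4 - z2 * z3)] = fst p"
    by (rule hopf_map_surj)
  obtain y1 y2 y3 y4 where y:
    "vector [y1\<^sup>2 + y2\<^sup>2 - y3\<^sup>2 - y4\<^sup>2, 2 * (y1 * y3 + y2 * y4), 2 * (y1 * y4 - y2 * y3)] = snd p"
    by (rule hopf_map_surj)
  obtain x :: "real^8" where "x$0 = z1" "x$1 = z2" "x$2 = y1" "x$3 = y2"
    "x$4 = z3" "x$5 = z4" "x$6 = y3" "x$7 = y4"
    by (rule vec_8_obtain)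
  with z y that[of x] show thesis by (simp add: Qmap_def)
qed

text \<open>On each of the two C^2 factors \<open>dQ x\<close> is twice a 3 by 4 matrix with
  orthogonal rows of squared length u (resp. v), so its transpose divided by 2u (resp. 2v) is a
  right inverse; this gives the coordinates of \<open>a\<close>.\<close>

lemma dQ_surj:
  assumes "Qmap x \<in> M_reg"
  obtains a where "dQ x a = w"
proof -
  define u v where "u = ulen (Qmap x)" and "v = vlen (Qmap x)"
  have uv: "u > 0" "v > 0" using M_reg_pos[OF assms] by (simp_all add: u_def v_def)
  have u: "u = (x$0)\<^sup>2 + (x$1)\<^sup>2 + (x$4)\<^sup>2 + (x$5)\<^sup>2"
    and v: "v = (x$2)\<^sup>2 + (x$3)\<^sup>2 + (x$6)\<^sup>2 + (x$7)\<^sup>2"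
    by (simp_all add: u_def v_def ulen_Qmap vlen_Qmap)
  obtain s t where s: "s = fst w" and t: "t = snd w" by blast
  define k l where "k = 1 / (2 * u)" and "l = 1 / (2 * v)"
  have k: "2 * ((x$0)\<^sup>2 + (x$1)\<^sup>2 + (x$4)\<^sup>2 + (x$5)\<^sup>2) * k = 1"
    and l: "2 * ((x$2)\<^sup>2 + (x$3)\<^sup>2 + (x$6)\<^sup>2 + (x$7)\<^sup>2) * l = 1"
    using uv unfolding u[symmetric] v[symmetric] by (simp_all add: k_def l_def)
  obtain a :: "real^8" where a:
    "a$0 = (x$0 * s$1 + x$4 * s$2 + x$5 * s$3) * k"
    "a$1 = (x$1 * s$1 + x$5 * s$2 - x$4 * s$3) * k"
    "a$2 = (x$2 * t$1 + x$6 * t$2 + x$7 * t$3) * l"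
    "a$3 = (x$3 * t$1 + x$7 * t$2 - x$6 * t$3) * l"
    "a$4 = (x$0 * s$2 - x$4 * s$1 - x$1 * s$3) * k"
    "a$5 = (x$1 * s$2 - x$5 * s$1 + x$0 * s$3) * k"
    "a$6 = (x$2 * t$2 - x$6 * t$1 - x$3 * t$3) * l"
    "a$7 = (x$3 * t$2 - x$7 * t$1 + x$2 * t$3) * l"
    by (rule vec_8_obtain)
  have "2 * (x$0 * a$0 + x$1 * a$1 - x$4 * a$4 - x$5 * a$5) = s$1"
    "2 * (x$0 * a$4 + x$4 * a$0 + x$1 * a$5 + x$5 * a$1) = s$2"
    "2 * (x$0 * a$5 + x$5 * a$0 - x$1 * a$4 - x$4 * a$1) = s$3"
    unfolding a using k by algebra+
  moreover have "2 * (x$2 * a$2 + x$3 * a$3 - x$6 * a$6 - x$7 * a$7) = t$1"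
    "2 * (x$2 * a$6 + x$6 * a$2 + x$3 * a$7 + x$7 * a$3) = t$2"
    "2 * (x$2 * a$7 + x$7 * a$2 - x$3 * a$6 - x$6 * a$3) = t$3"
    unfolding a using l by algebra+
  ultimately have "dQ x a = w"
    unfolding dQ_def scaleR_Pair scaleR_vector_3 prod_eq_iff vec_eq_iff forall_3 s t by simp
  thus thesis by (rule that)
qed

section \<open>Existence and uniqueness of the pushdown\<close>

lemma riemannian_metric_on_cong:
  assumes "\<And>p a b. p \<in> S \<Longrightarrow> g p a b = g' p a b"
  shows "riemannian_metric_on S g \<longleftrightarrow> riemannian_metric_on S g'"
proof (cases "open S")
  case True
  have "g p = g' p" if "p \<in> S" for p using assms[OF that] by blast
  moreover have "Cinf_on S (\<lambda>p. g p a b) \<longleftrightarrow> Cinf_on S (\<lambda>p. g' p a b)" for a b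
    by (rule Cinf_on_cong[OF True assms])
  ultimately show ?thesis by (simp add: riemannian_metric_on_def)
qed (simp add: riemannian_metric_on_def)

lemma riemannian_g2: "riemannian_metric_on M_reg g2"
  unfolding riemannian_metric_on_def
  using open_M_reg bilinear_g2 g2_commute g2_pos Cinf_on_g2 by blast

lemma Qmap_nonzero: "Qmap x \<in> M_reg \<Longrightarrow> x \<noteq> 0"
  using M_reg_pos(1)[of "Qmap x"] by (auto simp: ulen_Qmap)

text \<open>Since h_2(X,X) = N, the \<open>Theta\<close> term equals h_2(X,a) h_2(X,b) / N, exactly
  the correction in \<open>h_eq_g2\<close>; subtracting leaves equality of the pullbacks of
  \<open>g\<close> and \<open>g2\<close>.\<close>

lemma is_pushdown_iff:
  "is_pushdown 2 g \<longleftrightarrow> riemannian_metric_on M_reg g \<and>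
     (\<forall>x. Qmap x \<in> M_reg \<longrightarrow> (\<forall>a b. g (Qmap x) (dQ x a) (dQ x b) = g2 (Qmap x) (dQ x a) (dQ x b)))"
proof -
  have "h 2 x a b = pullback Qmap g x a b
        + 1/4 * h 2 x (X_field x) (X_field x) * tensor_prod (Theta 2) (Theta 2) x a b \<longleftrightarrow>
      g (Qmap x) (dQ x a) (dQ x b) = g2 (Qmap x) (dQ x a) (dQ x b)"
    if "Qmap x \<in> M_reg" for x a b
  proof -
    have N: "h 2 x (X_field x) (X_field x) = N_M (Qmap x)" "Nc 2 x = N_M (Qmap x)"
      using Nc_2[of x] by (simp_all add: Nc_def N_M_def)
    have "1/4 * h 2 x (X_field x) (X_field x) * tensor_prod (Theta 2) (Theta 2) x a b
      = h 2 x (X_field x) a * h 2 x (X_field x) b / N_M (Qmap x)"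
      using N_M_pos[OF that] by (simp add: tensor_prod_def Theta_def N)
    moreover have "pullback Qmap g x a b = g (Qmap x) (dQ x a) (dQ x b)"
      by (simp add: pullback_def differential_eq[OF Qmap_has_derivative])
    ultimately show ?thesis
      using h_eq_g2[OF that, of a b] by linarith
  qed
  thus ?thesis
    unfolding is_pushdown_def using Qmap_nonzero by blast
qed

text \<open>Each point of \<open>M_reg\<close> has the form \<open>Qmap x\<close> and each pair of
  tangent vectors there lifts through \<open>dQ x\<close>, so equal pullbacks force equal tensors;
  conversely \<open>g\<close> inherits the metric properties of \<open>g2\<close>.\<close>

lemma is_pushdown_2_iff_g2:
  "is_pushdown 2 g \<longleftrightarrow> (\<forall>p\<in>M_reg. \<forall>a b. g p a b = g2 p a b)"
proof
  assume "is_pushdown 2 g"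
  hence eq: "Qmap x \<in> M_reg \<Longrightarrow> g (Qmap x) (dQ x a) (dQ x b) = g2 (Qmap x) (dQ x a) (dQ x b)" for x a b
    by (simp add: is_pushdown_iff)
  show "\<forall>p\<in>M_reg. \<forall>a b. g p a b = g2 p a b"
  proof (intro ballI allI)
    fix p a b assume p: "p \<in> M_reg"
    obtain x where x: "Qmap x = p" by (rule Qmap_surj)
    with p dQ_surj obtain a' b' where "dQ x a' = a" "dQ x b' = b" by metis
    with eq[of x a' b'] x p show "g p a b = g2 p a b" by simp
  qed
next
  assume "\<forall>p\<in>M_reg. \<forall>a b. g p a b = g2 p a b"
  hence eq: "g p a b = g2 p a b" if "p \<in> M_reg" for p a b
    using that by blast
  show "is_pushdown 2 g"
    unfolding is_pushdown_iff
    using riemannian_metric_on_cong[of M_reg g g2, OF eq] riemannian_g2 eq by blast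
qed

theorem theorem4p10:
  fixes g :: "M_space tensor2"
  shows "(\<forall>x. x \<noteq> 0 \<longrightarrow>
            Nc 2 x = 6 * ulen (Qmap x) * vlen (Qmap x) - 2 * (uvec (Qmap x) \<bullet> vvec (Qmap x)))
       \<and> (is_pushdown 2 g \<longleftrightarrow>
           (\<forall>p\<in>M_reg. \<forall>a b.
              let N = 6 * ulen p * vlen p - 2 * (uvec p \<bullet> vvec p) in
              g p a b =
                1/2 * tensor_sq (differential RM) p a b
                + 1/2 * norm_sq_form (\<lambda>q w. differential uvec q w + differential vvec q w) p a b
                + 2 / N * norm_sq_form B_form p a b
                + 1 / (2 * N) * tensor_sq Gamma_plus p a b
                - 1 / (4 * N) * tensor_sq Gamma_minus p a b))"
  unfolding is_pushdown_2_iff_g2 g2_def N_M_def Let_def using Nc_2 by simp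

end
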